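(* Let $U$ be a non-empty finite set and let $R\subseteq U\times U$ be a binary relation on $U$. If $R$ is inverse serial, then for all $X\subseteq U$, $$\underline{apr}_{p\vee s}(X)\subseteq\underline{apr}_{p}(X)\subseteq\overline{apr}_{p}(X)\subseteq\overline{apr}_{p\vee s}(X).$$
   Context: $R$ is inverse serial if for each $x\in U$ there exists $y\in U$ with $(y,x)\in R$. For $x\in U$ put $R_s(x)=\{y\in U\mid (x,y)\in R\}$, $R_p(x)=\{y\in U\mid (y,x)\in R\}$, $R_{p\vee s}(x)=R_s(x)\cup R_p(x)$. For $i\in\{p,p\vee s\}$ and $X\subseteq U$, $\underline{apr}_i(X)=\{x\in U\mid R_i(x)\subseteq X\}$ and $\overline{apr}_i(X)=\{x\in U\mid R_i(x)\cap X\neq\emptyset\}$. *)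

theory Defs
  imports Main
begin

definition inverse_serial :: "'a set \<Rightarrow> ('a \<times> 'a) set \<Rightarrow> bool" where
  "inverse_serial U R \<longleftrightarrow> (\<forall>x\<in>U. \<exists>y\<in>U. (y, x) \<in> R)"

definition succ_nbhd :: "'a set \<Rightarrow> ('a \<times> 'a) set \<Rightarrow> 'a \<Rightarrow> 'a set" where
  "succ_nbhd U R x = {y \<in> U. (x, y) \<in> R}"

definition pred_nbhd :: "'a set \<Rightarrow> ('a \<times> 'a) set \<Rightarrow> 'a \<Rightarrow> 'a set" where
  "pred_nbhd U R x = {y \<in> U. (y, x) \<in> R}"

definition pred_or_succ_nbhd :: "'a set \<Rightarrow> ('a \<times> 'a) set \<Rightarrow> 'a \<Rightarrow> 'a set" where
  "pred_or_succ_nbhd U R x = succ_nbhd U R x \<union> pred_nbhd U R x"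

text \<open>The approximations take the neighbourhood operator \<open>N\<close> as an argument:
  \<open>N = pred_nbhd U R\<close> gives the index \<open>p\<close> and \<open>N = pred_or_succ_nbhd U R\<close>
  the index \<open>p \<or> s\<close>.\<close>

definition lower_apr :: "'a set \<Rightarrow> ('a \<Rightarrow> 'a set) \<Rightarrow> 'a set \<Rightarrow> 'a set" where
  "lower_apr U N X = {x \<in> U. N x \<subseteq> X}"

definition upper_apr :: "'a set \<Rightarrow> ('a \<Rightarrow> 'a set) \<Rightarrow> 'a set \<Rightarrow> 'a set" where
  "upper_apr U N X = {x \<in> U. N x \<inter> X \<noteq> {}}"

end

theory Submission
  imports Defs
begin

text \<open>The outer inclusions are monotonicity in the neighbourhood: \<open>pred_nbhd\<close>
  lies pointwise inside \<open>pred_or_succ_nbhd\<close>, and enlarging a neighbourhood makes it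
  harder to fit inside \<open>X\<close> but easier to meet \<open>X\<close>. The middle inclusion
  needs nonempty neighbourhoods, which for predecessors is what inverse seriality provides.\<close>

lemma lower_apr_antimono:
  assumes "\<And>x. x \<in> U \<Longrightarrow> M x \<subseteq> N x"
  shows "lower_apr U N X \<subseteq> lower_apr U M X"
  using assms unfolding lower_apr_def by blast

lemma upper_apr_mono:
  assumes "\<And>x. x \<in> U \<Longrightarrow> M x \<subseteq> N x"
  shows "upper_apr U M X \<subseteq> upper_apr U N X"
  using assms unfolding upper_apr_def by blast

text \<open>A nonempty set contained in \<open>X\<close> meets \<open>X\<close>. A point with empty
  neighbourhood would lie in the lower approximation but not in the upper one.\<close>

lemma lower_apr_subset_upper_apr:
  assumes "\<And>x. x \<in> U \<Longrightarrow> N x \<noteq> {}"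
  shows "lower_apr U N X \<subseteq> upper_apr U N X"
  using assms unfolding lower_apr_def upper_apr_def by blast

lemma pred_nbhd_nonempty:
  assumes "inverse_serial U R" and "x \<in> U"
  shows "pred_nbhd U R x \<noteq> {}"
  using assms unfolding inverse_serial_def pred_nbhd_def by blast

lemma pred_nbhd_subset: "pred_nbhd U R x \<subseteq> pred_or_succ_nbhd U R x"
  unfolding pred_or_succ_nbhd_def by blast

theorem corollary26:
  fixes U X :: "'a set" and R :: "('a \<times> 'a) set"
  assumes "finite U" and "U \<noteq> {}"
    and "R \<subseteq> U \<times> U"
    and "inverse_serial U R"
    and "X \<subseteq> U"
  shows "lower_apr U (pred_or_succ_nbhd U R) X \<subseteq> lower_apr U (pred_nbhd U R) X
    \<and> lower_apr U (pred_nbhd U R) X \<subseteq> upper_apr U (pred_nbhd U R) X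
    \<and> upper_apr U (pred_nbhd U R) X \<subseteq> upper_apr U (pred_or_succ_nbhd U R) X"
  \<comment> \<open>The pair of operators in each inclusion (lower/lower, upper/upper, lower/upper)
    selects the one general lemma that fits.\<close>
  by (intro conjI lower_apr_antimono upper_apr_mono lower_apr_subset_upper_apr
      pred_nbhd_subset pred_nbhd_nonempty[OF assms(4)])

end
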